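(* Let $\omega=dy_1\wedge dy_2$ on $\mathbb{R}^3$ (coordinates $(y_1,y_2,y_3)$). For every $\lambda<2$ there exists a finite distortion $\omega$-curve $f:\mathbb{R}^2\to\mathbb{R}^3$, with distortion function $K_f$, such that $f\in W^{1,2}_{loc}(\mathbb{R}^2,\mathbb{R}^3)$ and $\exp(\lambda K_f)\in L^1_{loc}(\mathbb{R}^2)$, but $f$ does not have a continuous representative (i.e. no continuous map agrees with $f$ almost everywhere).
   Context: Let $n\le m$ and let $\Omega\subset\mathbb{R}^n$ be a domain. An $n$-volume form on $\mathbb{R}^m$ is a smooth, non-vanishing, closed differential $n$-form $\omega$. Its pointwise comass norm is $\|\omega\|(p)=\sup\{|\omega_p(v_1,\dots,v_n)|: v_1,\dots,v_n\in\mathbb{R}^m,\ |v_i|\le 1\}$. For a Sobolev map $f$, $\star f^*\omega$ denotes the real-valued function with $(\star f^*\omega)\,dx_1\wedge\dots\wedge dx_n=f^*\omega$ (pullback computed with weak derivatives). $|Df(x)|$ is the operator norm of the weak differential. Finite distortion $\omega$-curve: a map $f\in W^{1,1}_{loc}(\Omega,\mathbb{R}^m)$ such that $\star f^*\omega\in L^1_{loc}(\Omega)$ and there is a measurable function $K_f\ge 1$, finite almost everywhere (the distortion function), with $(\|\omega\|\circ f)(x)\,|Df(x)|^n\le K_f(x)\,(\star f^*\omega)(x)$ for almost every $x\in\Omega$. *)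

theory Defs
  imports "HOL-Analysis.Analysis"
begin

section \<open>Smooth functions and Sobolev maps\<close>

primrec Ck :: "nat \<Rightarrow> ('a::euclidean_space \<Rightarrow> real) \<Rightarrow> bool" where
  "Ck 0 f \<longleftrightarrow> continuous_on UNIV f"
| "Ck (Suc k) f \<longleftrightarrow> (\<forall>x. f differentiable (at x)) \<and>
     (\<forall>b\<in>Basis. Ck k (\<lambda>x. frechet_derivative f (at x) b))"

definition smooth :: "('a::euclidean_space \<Rightarrow> real) \<Rightarrow> bool" where
  "smooth f \<longleftrightarrow> (\<forall>k. Ck k f)"

text \<open>Elements of \<open>C\<^sub>c\<^sup>\<infinity>(\<Omega>)\<close>, extended by zero to the whole space.\<close>

definition test_function :: "'a::euclidean_space set \<Rightarrow> ('a \<Rightarrow> real) \<Rightarrow> bool" where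
  "test_function \<Omega> \<phi> \<longleftrightarrow> smooth \<phi> \<and>
     compact (closure {x. \<phi> x \<noteq> 0}) \<and> closure {x. \<phi> x \<noteq> 0} \<subseteq> \<Omega>"

definition Lp_loc :: "'a::euclidean_space set \<Rightarrow> real \<Rightarrow> ('a \<Rightarrow> 'b::euclidean_space) \<Rightarrow> bool" where
  "Lp_loc \<Omega> p f \<longleftrightarrow> f \<in> borel_measurable (lebesgue_on \<Omega>) \<and>
     (\<forall>C. compact C \<and> C \<subseteq> \<Omega> \<longrightarrow> set_integrable lebesgue C (\<lambda>x. norm (f x) powr p))"

text \<open>The weak differential at \<open>x\<close> is given as the Jacobian matrix \<open>D x\<close>, with
  \<open>D x $ k $ i\<close> the weak partial derivative of the \<open>k\<close>-th component in direction \<open>i\<close>.\<close>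

definition weak_differential ::
  "(real^'n) set \<Rightarrow> (real^'n \<Rightarrow> real^'m) \<Rightarrow> (real^'n \<Rightarrow> real^'n^'m) \<Rightarrow> bool" where
  "weak_differential \<Omega> f D \<longleftrightarrow> Lp_loc \<Omega> 1 f \<and> Lp_loc \<Omega> 1 D \<and>
     (\<forall>\<phi> i k. test_function \<Omega> \<phi> \<longrightarrow>
        (LINT x:\<Omega>|lebesgue. f x $ k * frechet_derivative \<phi> (at x) (axis i 1)) =
        - (LINT x:\<Omega>|lebesgue. D x $ k $ i * \<phi> x))"

definition W1p_loc :: "(real^'n) set \<Rightarrow> real \<Rightarrow> (real^'n \<Rightarrow> real^'m) \<Rightarrow> bool" where
  "W1p_loc \<Omega> p f \<longleftrightarrow> Lp_loc \<Omega> p f \<and> (\<exists>D. weak_differential \<Omega> f D \<and> Lp_loc \<Omega> p D)"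

definition has_continuous_representative ::
  "'a::euclidean_space set \<Rightarrow> ('a \<Rightarrow> 'b::euclidean_space) \<Rightarrow> bool" where
  "has_continuous_representative \<Omega> f \<longleftrightarrow>
     (\<exists>g. continuous_on \<Omega> g \<and> (AE x in lebesgue_on \<Omega>. g x = f x))"


section \<open>Differential forms\<close>

text \<open>An \<open>n\<close>-covector on \<open>real^'m\<close> takes an \<open>n\<close>-tuple of vectors \<open>v :: real^'m^'n\<close>,
  whose \<open>i\<close>-th entry is \<open>v $ i\<close>; an \<open>n\<close>-form assigns an \<open>n\<close>-covector to each point.\<close>

type_synonym ('n, 'm) covector = "real^'m^'n \<Rightarrow> real"
type_synonym ('n, 'm) form = "real^'m \<Rightarrow> ('n, 'm) covector"

definition alternating :: "('n::finite, 'm::finite) covector \<Rightarrow> bool" where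
  "alternating \<alpha> \<longleftrightarrow>
     (\<forall>v j. linear (\<lambda>u. \<alpha> (\<chi> i. if i = j then u else v $ i))) \<and>
     (\<forall>v i j. i \<noteq> j \<and> v $ i = v $ j \<longrightarrow> \<alpha> v = 0)"

text \<open>The exterior derivative evaluated at the \<open>(n+1)\<close>-tuple \<open>(u, v\<^sub>1, \<dots>, v\<^sub>n)\<close>. In the usual
  formula the term differentiated along \<open>v\<^sub>j\<close> is
  \<open>(-1)^j \<omega>(u, v\<^sub>1, \<dots>, v\<^sub>j\<^sub>-\<^sub>1, v\<^sub>j\<^sub>+\<^sub>1, \<dots>, v\<^sub>n)\<close>. Moving \<open>u\<close> into the \<open>j\<close>-th slot costs \<open>(-1)^(j-1)\<close>,
  so every such term has sign \<open>-1\<close> and no ordering of the index type is needed.\<close>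

definition exterior_derivative ::
  "('n::finite, 'm::finite) form \<Rightarrow> real^'m \<Rightarrow> real^'m \<Rightarrow> real^'m^'n \<Rightarrow> real" where
  "exterior_derivative \<omega> p u v =
     frechet_derivative (\<lambda>q. \<omega> q v) (at p) u -
     (\<Sum>j\<in>UNIV. frechet_derivative (\<lambda>q. \<omega> q (\<chi> i. if i = j then u else v $ i)) (at p) (v $ j))"

definition volume_form :: "('n::finite, 'm::finite) form \<Rightarrow> bool" where
  "volume_form \<omega> \<longleftrightarrow>
     (\<forall>p. alternating (\<omega> p)) \<and>
     (\<forall>v. smooth (\<lambda>p. \<omega> p v)) \<and>
     (\<forall>p. \<exists>v. \<omega> p v \<noteq> 0) \<and>
     (\<forall>p u v. exterior_derivative \<omega> p u v = 0)"

definition comass :: "('n::finite, 'm::finite) form \<Rightarrow> real^'m \<Rightarrow> real" where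
  "comass \<omega> p = (SUP v\<in>{v. \<forall>i. norm (v $ i) \<le> 1}. \<bar>\<omega> p v\<bar>)"

definition pullback :: "real^'n^'m \<Rightarrow> ('k::finite, 'm::finite) covector \<Rightarrow> ('k, 'n::finite) covector" where
  "pullback A \<alpha> v = \<alpha> (\<chi> i. A *v (v $ i))"

text \<open>On an \<open>n\<close>-tuple of vectors of \<open>real^'n\<close>, \<open>dx\<^sub>1 \<and> \<dots> \<and> dx\<^sub>n\<close> is the determinant.\<close>

definition star :: "('n::finite, 'n) covector \<Rightarrow> real" where
  "star \<alpha> = (THE c. \<forall>v. \<alpha> v = c * det v)"

definition coord_form :: "'m::finite \<Rightarrow> real^'m \<Rightarrow> real^'m \<Rightarrow> real" where
  "coord_form i p v = v $ i"

definition wedge ::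
  "(real^'m \<Rightarrow> real^'m \<Rightarrow> real) \<Rightarrow> (real^'m \<Rightarrow> real^'m \<Rightarrow> real) \<Rightarrow> (2, 'm::finite) form" where
  "wedge \<alpha> \<beta> p v = \<alpha> p (v $ 1) * \<beta> p (v $ 2) - \<alpha> p (v $ 2) * \<beta> p (v $ 1)"


section \<open>Curves of finite distortion\<close>

text \<open>The weak differential \<open>D\<close> is unique up to null sets, so its choice does not matter.
  The distortion function may take the value \<open>\<infinity>\<close> on a null set, hence the type \<^typ>\<open>ereal\<close>.\<close>

definition finite_distortion_curve ::
  "(real^'n) set \<Rightarrow> ('n::finite, 'm::finite) form \<Rightarrow> (real^'n \<Rightarrow> real^'m) \<Rightarrow> (real^'n \<Rightarrow> ereal) \<Rightarrow> bool"
where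
  "finite_distortion_curve \<Omega> \<omega> f K \<longleftrightarrow>
     CARD('n) \<le> CARD('m) \<and> open \<Omega> \<and> connected \<Omega> \<and> \<Omega> \<noteq> {} \<and> volume_form \<omega> \<and>
     W1p_loc \<Omega> 1 f \<and>
     K \<in> borel_measurable (lebesgue_on \<Omega>) \<and>
     (\<forall>x\<in>\<Omega>. 1 \<le> K x) \<and> (AE x in lebesgue_on \<Omega>. K x < \<infinity>) \<and>
     (\<exists>D. weak_differential \<Omega> f D \<and>
        Lp_loc \<Omega> 1 (\<lambda>x. star (pullback (D x) (\<omega> (f x)))) \<and>
        (AE x in lebesgue_on \<Omega>.
           ereal (comass \<omega> (f x) * onorm ((*v) (D x)) ^ CARD('n)) \<le>
           K x * ereal (star (pullback (D x) (\<omega> (f x))))))"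


section \<open>Well-definedness\<close>

lemma alternating_linear:
  "alternating \<alpha> \<Longrightarrow> linear (\<lambda>u. \<alpha> (\<chi> i. if i = j then u else v $ i))"
  by (simp add: alternating_def)

lemma alternating_eq:
  "alternating \<alpha> \<Longrightarrow> i \<noteq> j \<Longrightarrow> v $ i = v $ j \<Longrightarrow> \<alpha> v = 0"
  unfolding alternating_def by blast

lemma alternating_swap:
  fixes \<alpha> :: "('n::finite, 'm::finite) covector"
  assumes "alternating \<alpha>" "a \<noteq> b"
  shows "\<alpha> (\<chi> i. v $ Transposition.transpose a b i) = - \<alpha> v"
proof -
  define F where "F x y = \<alpha> (\<chi> i. if i = a then x else if i = b then y else v $ i)" for x y
  have F1: "linear (\<lambda>x. F x y)" for y
    using alternating_linear[OF assms(1), of a "\<chi> i. if i = b then y else v $ i"]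
    unfolding F_def vec_lambda_beta .
  have F2: "linear (F x)" for x
  proof -
    have "F x = (\<lambda>u. \<alpha> (\<chi> i. if i = b then u else (\<chi> i. if i = a then x else v $ i) $ i))"
      unfolding F_def using assms(2) by (intro ext arg_cong[of _ _ \<alpha>]) (auto simp: vec_eq_iff)
    then show ?thesis using alternating_linear[OF assms(1)] by simp
  qed
  have F0: "F x x = 0" for x
    unfolding F_def by (rule alternating_eq[OF assms]) (use assms(2) in auto)
  have "F (v $ a + v $ b) (v $ a + v $ b) =
      F (v $ a) (v $ a) + F (v $ a) (v $ b) + (F (v $ b) (v $ a) + F (v $ b) (v $ b))"
    unfolding linear_add[OF F1] linear_add[OF F2] by simp
  then have "F (v $ b) (v $ a) = - F (v $ a) (v $ b)"
    unfolding F0 by simp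
  moreover have "F (v $ b) (v $ a) = \<alpha> (\<chi> i. v $ Transposition.transpose a b i)"
    unfolding F_def by (intro arg_cong[of _ _ \<alpha>])
      (use assms(2) in \<open>auto simp: vec_eq_iff Transposition.transpose_def\<close>)
  moreover have "F (v $ a) (v $ b) = \<alpha> v"
    unfolding F_def by (intro arg_cong[of _ _ \<alpha>]) (auto simp: vec_eq_iff)
  ultimately show ?thesis by simp
qed

lemma alternating_pullback:
  fixes A :: "real^'n^'m" and \<alpha> :: "('k::finite, 'm::finite) covector"
  assumes "alternating \<alpha>"
  shows "alternating (pullback A \<alpha>)"
  unfolding alternating_def
proof (intro conjI allI impI)
  fix v :: "real^'n^'k" and j
  have "(\<lambda>u. pullback A \<alpha> (\<chi> i. if i = j then u else v $ i)) =
        (\<lambda>u. \<alpha> (\<chi> i. if i = j then u else (\<chi> i. A *v (v $ i)) $ i)) \<circ> (*v) A"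
    unfolding pullback_def o_def by (intro ext arg_cong[of _ _ \<alpha>]) (auto simp: vec_eq_iff)
  then show "linear (\<lambda>u. pullback A \<alpha> (\<chi> i. if i = j then u else v $ i))"
    by (simp only: linear_compose[OF matrix_vector_mul_linear alternating_linear[OF assms]])
next
  fix v :: "real^'n^'k" and i j
  assume "i \<noteq> j \<and> v $ i = v $ j"
  then show "pullback A \<alpha> v = 0"
    unfolding pullback_def by (intro alternating_eq[OF assms, of i j]) auto
qed

lemma alternating_eq_det:
  fixes \<alpha> :: "('n::finite, 'n) covector"
  assumes "alternating \<alpha>"
  shows "\<alpha> A = \<alpha> (mat 1) * det A"
proof -
  have "\<forall>\<alpha>::('n, 'n) covector. alternating \<alpha> \<longrightarrow> \<alpha> A = \<alpha> (mat 1) * det A"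
  proof (induction A rule: induct_matrix_row_operations)
    case (1 A i)
    show ?case
    proof (intro allI impI)
      fix \<alpha> :: "('n, 'n) covector" assume a: "alternating \<alpha>"
      have "(\<chi> k. if k = i then 0 else A $ k) = A"
        using 1 by (auto simp: vec_eq_iff row_def)
      then have "\<alpha> A = 0"
        using linear_0[OF alternating_linear[OF a, of i A]] by simp
      moreover have "det A = 0" using 1 by (rule det_zero_row)
      ultimately show "\<alpha> A = \<alpha> (mat 1) * det A" by simp
    qed
  next
    case (2 A)
    show ?case
    proof (intro allI impI)
      fix \<alpha> :: "('n, 'n) covector" assume a: "alternating \<alpha>"
      have "\<alpha> (\<chi> i. if i \<in> S then A $ i else axis i 1) = \<alpha> (mat 1) * (\<Prod>i\<in>S. A $ i $ i)"
        if "finite S" for S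
        using that
      proof (induction S)
        case empty
        have "(\<chi> i. axis i 1) = (mat 1 :: real^'n^'n)"
          by (auto simp: vec_eq_iff mat_def axis_def)
        then show ?case by simp
      next
        case (insert s S)
        let ?w = "(\<chi> i. if i \<in> S then A $ i else axis i 1) :: real^'n^'n"
        have "A $ s $ s *\<^sub>R axis s 1 = A $ s"
          using 2 by (auto simp: vec_eq_iff axis_def)
        then have "(\<chi> i. if i \<in> insert s S then A $ i else axis i 1)
            = (\<chi> i. if i = s then A $ s $ s *\<^sub>R axis s 1 else ?w $ i)"
          by (auto simp: vec_eq_iff)
        moreover have "(\<chi> i. if i = s then axis s 1 else ?w $ i) = ?w"
          using insert by (auto simp: vec_eq_iff)
        ultimately show ?case
          using linear_scale[OF alternating_linear[OF a, of s ?w], of "A $ s $ s" "axis s 1"] insert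
          by simp
      qed
      from this[of UNIV] show "\<alpha> A = \<alpha> (mat 1) * det A"
        using det_diagonal[of A] 2 by simp
    qed
  next
    case (3 A m n)
    show ?case
    proof (intro allI impI)
      fix \<alpha> :: "('n, 'n) covector" assume a: "alternating \<alpha>"
      let ?t = "Transposition.transpose m n"
      let ?L = "\<lambda>x::real^'n. \<chi> j. x $ ?t j"
      let ?Q = "matrix ?L"
      have "linear ?L" by (rule linearI) (auto simp: vec_eq_iff)
      then have Q: "?Q *v x = ?L x" for x by (simp add: matrix_works)
      have "\<alpha> (\<chi> i j. A $ i $ ?t j) = pullback ?Q \<alpha> A"
        by (simp add: pullback_def Q)
      also have "\<dots> = pullback ?Q \<alpha> (mat 1) * det A"
        using 3(1) alternating_pullback[OF a] by blast
      also have "pullback ?Q \<alpha> (mat 1) = \<alpha> (\<chi> i. mat 1 $ ?t i)"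
        unfolding pullback_def Q
        by (intro arg_cong[of _ _ \<alpha>])
           (auto simp: vec_eq_iff mat_def Transposition.transpose_def)
      also have "\<dots> = - \<alpha> (mat 1)"
        by (rule alternating_swap[OF a 3(2)])
      also have "det A = - det (\<chi> i j. A $ i $ ?t j)"
        using det_permute_columns[of ?t A] 3(2)
        by (simp add: permutes_swap_id sign_swap_id)
      finally show "\<alpha> (\<chi> i j. A $ i $ ?t j) = \<alpha> (mat 1) * det (\<chi> i j. A $ i $ ?t j)"
        by simp
    qed
  next
    case (4 A m n c)
    show ?case
    proof (intro allI impI)
      fix \<alpha> :: "('n, 'n) covector" assume a: "alternating \<alpha>"
      let ?B = "\<chi> i. if i = m then row m A + c *\<^sub>R row n A else row i A"
      note lin = alternating_linear[OF a, of m A]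
      have "?B = (\<chi> i. if i = m then A $ m + c *\<^sub>R A $ n else A $ i)"
        by (auto simp: vec_eq_iff row_def)
      then have "\<alpha> ?B = \<alpha> (\<chi> i. if i = m then A $ m else A $ i)
          + c * \<alpha> (\<chi> i. if i = m then A $ n else A $ i)"
        using linear_add[OF lin, of "A $ m" "c *\<^sub>R A $ n"] linear_scale[OF lin, of c "A $ n"] by simp
      moreover have "(\<chi> i. if i = m then A $ m else A $ i) = A"
        by (auto simp: vec_eq_iff)
      moreover have "\<alpha> (\<chi> i. if i = m then A $ n else A $ i) = 0"
        by (rule alternating_eq[OF a 4(2)]) (use 4(2) in auto)
      moreover have "det ?B = det A"
        using det_row_operation[OF 4(2), of A c] unfolding scalar_mult_eq_scaleR .
      ultimately show "\<alpha> ?B = \<alpha> (mat 1) * det ?B"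
        using 4(1) a by simp
    qed
  qed
  then show ?thesis using assms by blast
qed

lemma star_eq:
  fixes \<alpha> :: "('n::finite, 'n) covector"
  assumes "alternating \<alpha>"
  shows "star \<alpha> = \<alpha> (mat 1)"
  unfolding star_def
proof (rule the_equality)
  show "\<forall>v. \<alpha> v = \<alpha> (mat 1) * det v"
    using alternating_eq_det[OF assms] by blast
next
  fix c assume "\<forall>v. \<alpha> v = c * det v"
  then show "c = \<alpha> (mat 1)" by simp
qed

lemma star_works:
  "alternating \<alpha> \<Longrightarrow> \<alpha> v = star \<alpha> * det v"
  using alternating_eq_det star_eq by metis

lemma Ck_const: "Ck k (\<lambda>x. c)"
  by (induction k arbitrary: c) auto

lemma volume_form_wedge_coord:
  assumes "a \<noteq> b"
  shows "volume_form (wedge (coord_form a) (coord_form b))"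
  unfolding volume_form_def
proof (intro conjI allI)
  fix p :: "real^'a"
  show "alternating (wedge (coord_form a) (coord_form b) p)"
    unfolding alternating_def
  proof (intro conjI allI impI)
    fix v :: "real^'a^2" and j :: 2
    show "linear (\<lambda>u. wedge (coord_form a) (coord_form b) p (\<chi> i. if i = j then u else v $ i))"
      using exhaust_2[of j]
      by (intro linearI) (auto simp: wedge_def coord_form_def algebra_simps)
  next
    fix v :: "real^'a^2" and i j :: 2
    assume "i \<noteq> j \<and> v $ i = v $ j"
    then have "v $ 1 = v $ 2" using exhaust_2[of i] exhaust_2[of j] by auto
    then show "wedge (coord_form a) (coord_form b) p v = 0"
      by (simp add: wedge_def)
  qed
  have "wedge (coord_form a) (coord_form b) p (\<chi> i. if i = 1 then axis a 1 else axis b 1) \<noteq> 0"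
    using assms by (simp add: wedge_def coord_form_def axis_def)
  then show "\<exists>v. wedge (coord_form a) (coord_form b) p v \<noteq> 0" by blast
qed (auto simp: smooth_def Ck_const exterior_derivative_def wedge_def coord_form_def)

end

theory Submission
  imports Defs
begin

text \<open>
  Put \<open>l(r) = 1 + ln (1 + 1/r)\<close> and let \<open>f(x) = (x / (r l), ln l)\<close> with \<open>r = |x|\<close>. The height \<open>ln l\<close> is
  the standard unbounded \<open>W\<^sup>1\<^sup>,\<^sup>2\<close> function of the plane. The horizontal part is radial, with profile
  \<open>1/l\<close> chosen so that its Jacobian \<open>1 / (r\<^sup>2 (1 + r) l\<^sup>3)\<close> is smaller than
  \<open>|Df|\<^sup>2 \<le> (1 + 1/l\<^sup>2) / (r l)\<^sup>2\<close> only by the factor \<open>(1 + r) (l + 1/l) \<le> l + 2r + 2\<close>. Hence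
  \<open>exp (\<lambda> K)\<close> blows up like \<open>r\<^sup>-\<^sup>\<lambda>\<close> at the origin, which is integrable in the plane for \<open>\<lambda> < 2\<close>.
\<close>

section \<open>Integrability and weak derivatives of functions singular at the origin\<close>

text \<open>Each dyadic annulus in the unit ball is enlarged to the ball of radius
  \<open>1 / 2 ^ k\<close>, whose volume is a constant times \<open>(1 / 2 ^ k) ^ DIM('a)\<close>.
  The series in the summability assumption is therefore, up to that constant, the integral of a
  majorant of \<open>F\<close> near the origin.\<close>

lemma set_integrable_dyadic:
  fixes F :: "'a::euclidean_space \<Rightarrow> real"
  assumes meas: "F \<in> borel_measurable lborel" and C: "compact C"
    and c: "\<And>k. 0 \<le> c k"
    and inner: "\<And>k x. 1 / 2 ^ Suc k < norm x \<Longrightarrow> norm x \<le> 1 / 2 ^ k \<Longrightarrow> \<bar>F x\<bar> \<le> c k"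
    and summ: "summable (\<lambda>k. c k * (1 / 2 ^ k) ^ DIM('a))"
    and outer: "\<And>x. x \<in> C \<Longrightarrow> 1 < norm x \<Longrightarrow> \<bar>F x\<bar> \<le> B"
  shows "set_integrable lebesgue C F"
proof -
  define V where "V = unit_ball_vol (real DIM('a))"
  have V: "0 \<le> V" by (simp add: V_def)
  have [measurable]: "C \<in> sets borel" using C by (simp add: borel_compact)
  have [measurable]: "cball (0::'a) r \<in> sets borel" for r by (simp add: borel_closed)
  note meas[measurable]
  let ?S = "\<lambda>x. (\<Sum>k. ennreal (c k) * indicator (cball 0 (1 / 2 ^ k)) x) + ennreal B * indicator C x"
  have bound: "ennreal (norm (indicator C x *\<^sub>R F x)) \<le> ?S x" if "x \<noteq> 0" for x
  proof (cases "x \<in> C")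
    case True
    show ?thesis
    proof (cases "1 < norm x")
      case True
      have "ennreal \<bar>F x\<bar> \<le> ennreal B"
        using outer[OF \<open>x \<in> C\<close> True] by (rule ennreal_leI)
      also have "\<dots> \<le> ?S x" using \<open>x \<in> C\<close> by simp
      finally show ?thesis using \<open>x \<in> C\<close> by simp
    next
      case False
      \<comment> \<open>The least such \<open>k\<close> is positive because
        \<open>norm x \<le> 1\<close>; its predecessor \<open>j\<close> indexes the annulus
        containing \<open>x\<close>.\<close>
      have "\<exists>k. 1 / 2 ^ k < norm x"
        using real_arch_pow_inv[of "norm x" "1/2"] that by (auto simp: power_divide)
      then obtain k where "1 / 2 ^ k < norm x" "\<And>j. j < k \<Longrightarrow> \<not> 1 / 2 ^ j < norm x"
        using exists_least_iff[of "\<lambda>k. 1 / 2 ^ k < norm x"] by blast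
      moreover from this False obtain j where "k = Suc j" by (cases k) auto
      ultimately have j: "1 / 2 ^ Suc j < norm x" "norm x \<le> 1 / 2 ^ j" by (auto simp: not_less)
      have "ennreal \<bar>F x\<bar> \<le> ennreal (c j)"
        using inner[OF j] by (rule ennreal_leI)
      also have "\<dots> = ennreal (c j) * indicator (cball 0 (1 / 2 ^ j)) x" using j by simp
      also have "\<dots> \<le> (\<Sum>k. ennreal (c k) * indicator (cball 0 (1 / 2 ^ k)) x)"
        using sum_le_suminf[of "\<lambda>k. ennreal (c k) * indicator (cball 0 (1 / 2 ^ k)) x" "{j}"]
        by (simp only: summableI finite.intros sum.insert sum.empty
            empty_iff add_0_right not_False_eq_True zero_le simp_thms ball_simps)
      also have "\<dots> \<le> ?S x" by simp
      finally show ?thesis using \<open>x \<in> C\<close> by simp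
    qed
  qed simp
  have "(\<integral>\<^sup>+x. ennreal (norm (indicator C x *\<^sub>R F x)) \<partial>lborel) \<le> (\<integral>\<^sup>+x. ?S x \<partial>lborel)"
    by (rule nn_integral_mono_AE) (use AE_lborel_singleton[of 0] bound in auto)
  also have "\<dots> = (\<integral>\<^sup>+x. (\<Sum>k. ennreal (c k) * indicator (cball 0 (1 / 2 ^ k)) (x :: 'a)) \<partial>lborel) +
      (\<integral>\<^sup>+x. ennreal B * indicator C x \<partial>lborel)"
    by (intro nn_integral_add) measurable
  also have "(\<integral>\<^sup>+x. (\<Sum>k. ennreal (c k) * indicator (cball 0 (1 / 2 ^ k)) (x :: 'a)) \<partial>lborel) =
      (\<Sum>k. \<integral>\<^sup>+x. ennreal (c k) * indicator (cball 0 (1 / 2 ^ k)) (x :: 'a) \<partial>lborel)"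
    by (intro nn_integral_suminf) measurable
  also have "\<dots> = (\<Sum>k. ennreal (c k) * ennreal (V * (1 / 2 ^ k) ^ DIM('a)))"
    by (simp add: nn_integral_cmult emeasure_cball V_def)
  also have "(\<integral>\<^sup>+x. ennreal B * indicator C x \<partial>lborel) = ennreal B * emeasure lborel C"
    by (simp add: nn_integral_cmult)
  also have "(\<Sum>k. ennreal (c k) * ennreal (V * (1 / 2 ^ k) ^ DIM('a))) =
      (\<Sum>k. ennreal (V * (c k * (1 / 2 ^ k) ^ DIM('a))))"
    using c V by (simp add: ennreal_mult' [symmetric] mult_ac)
  also have "\<dots> + ennreal B * emeasure lborel C < \<infinity>"
    using c V summable_mult[OF summ, of V] emeasure_compact_finite[OF C]
    by (subst suminf_ennreal2) (auto simp: ennreal_mult_less_top)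
  finally have "integrable lborel (\<lambda>x. indicator C x *\<^sub>R F x)"
    by (intro integrableI_bounded) auto
  then show ?thesis
    unfolding set_integrable_def by (subst integrable_completion) auto
qed

text \<open>Integrate \<open>g (x + t e)\<close> over \<open>x\<close> and \<open>t \<in> [0, 1]\<close>. Integrating in \<open>x\<close> first gives \<open>\<integral> g\<close>; integrating
  in \<open>t\<close> first gives \<open>\<integral> (G (x + e) - G x) dx = 0\<close>, because almost every line in direction \<open>e\<close> misses
  the singularity.\<close>

lemma integral_directional_derivative_eq_0:
  fixes G g :: "'a::euclidean_space \<Rightarrow> real" and e :: 'a
  assumes dim: "2 \<le> DIM('a)"
    and G: "integrable lborel G" and g: "integrable lborel g"
    and cont: "continuous_on (- {0}) g"
    and deriv: "\<And>x. x \<noteq> 0 \<Longrightarrow> ((\<lambda>t. G (x + t *\<^sub>R e)) has_real_derivative g x) (at 0)"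
  shows "(LINT x|lborel. g x) = 0"
proof -
  have [measurable]: "G \<in> borel_measurable borel" "g \<in> borel_measurable borel"
    using G g by auto
  have shift: "integrable lborel (\<lambda>x. h (x + c))" "(LINT x|lborel. h (x + c)) = (LINT x|lborel. h x)"
    if h: "integrable lborel h" for h :: "'a \<Rightarrow> real" and c
  proof -
    have "integrable (distr lborel borel ((+) c)) h"
      using h by (simp add: lborel_distr_plus)
    then show "integrable lborel (\<lambda>x. h (x + c))"
      by (subst (asm) integrable_distr_eq) (use h in \<open>simp_all add: add.commute\<close>)
    have "(LINT x|lborel. h x) = (LINT x|distr lborel borel ((+) c). h x)"
      by (simp add: lborel_distr_plus)
    also have "\<dots> = (LINT x|lborel. h (x + c))"
      using h by (subst integral_distr) (simp_all add: add.commute)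
    finally show "(LINT x|lborel. h (x + c)) = (LINT x|lborel. h x)" ..
  qed
  define F where "F t x = indicator {0..1} t * g (x + t *\<^sub>R e)" for t x
  have F_measurable: "case_prod F \<in> borel_measurable (lborel \<Otimes>\<^sub>M lborel)"
    unfolding F_def by measurable
  \<comment> \<open>By translation invariance the integral of \<open>\<bar>F t x\<bar>\<close> over
    \<open>x\<close> is the same number for every \<open>t\<close> in the unit interval.\<close>
  have int: "integrable (lborel \<Otimes>\<^sub>M lborel) (case_prod F)"
  proof (rule lborel_pair.Fubini_integrable[OF F_measurable])
    show "AE t in lborel. integrable lborel (\<lambda>x. case (t, x) of (t, x) \<Rightarrow> F t x)"
      using shift(1)[OF g] by (simp add: F_def)
    have "(LINT x|lborel. norm (case (t, x) of (t, x) \<Rightarrow> F t x)) =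
        indicator {0..1} t * (LINT x|lborel. \<bar>g x\<bar>)" for t
      using shift(2)[OF integrable_abs[OF g]] by (simp add: F_def abs_mult)
    then show "integrable lborel (\<lambda>t. LINT x|lborel. norm (case (t, x) of (t, x) \<Rightarrow> F t x))"
      by simp
  qed
  \<comment> \<open>The points whose line in direction \<open>e\<close> meets the origin form
    \<open>span {e}\<close>, which is a null set since the dimension is at least 2.\<close>
  have line: "AE x in lborel. x \<notin> span {e}"
  proof -
    have "dim (span {e}) < DIM('a)"
      using dim dim_le_card[of "{e}" "{e}"] by (auto simp: span_base)
    then have "negligible (span {e})" by (rule negligible_lowdim)
    then have "AE x in lebesgue. x \<notin> span {e}"
      by (intro AE_not_in) (simp add: negligible_iff_null_sets)
    then show ?thesis by (simp add: AE_completion_iff)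
  qed
  have increment: "(LINT t|lborel. F t x) = G (x + e) - G x" if "x \<notin> span {e}" for x
  proof -
    have nz: "x + t *\<^sub>R e \<noteq> 0" for t
    proof
      assume "x + t *\<^sub>R e = 0"
      then have "x = (- t) *\<^sub>R e" by (simp add: eq_neg_iff_add_eq_0)
      then show False using that by (simp add: span_base span_scale span_neg)
    qed
    \<comment> \<open>The derivative at time \<open>t\<close> along the line from \<open>x\<close>
      is the derivative at time 0 along the line from \<open>x + t *\<^sub>R e\<close>.\<close>
    have d: "((\<lambda>t. G (x + t *\<^sub>R e)) has_real_derivative g (x + t *\<^sub>R e)) (at t)" for t
      using deriv[OF nz, of t] DERIV_shift[of "\<lambda>s. G (x + s *\<^sub>R e)" "g (x + t *\<^sub>R e)" 0 t]
      by (simp add: algebra_simps)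
    have "isCont g y" if "y \<noteq> 0" for y
      using continuous_on_eq_continuous_at[of "- {0}" g] cont \<open>y \<noteq> 0\<close> by (simp add: open_Compl)
    then have c: "isCont (\<lambda>t. g (x + t *\<^sub>R e)) t" for t
      using isCont_o2[of t "\<lambda>t. x + t *\<^sub>R e" g] nz[of t] by (simp add: continuous_intros)
    show ?thesis
      using integral_FTC_Icc_real[of 0 1 "\<lambda>t. G (x + t *\<^sub>R e)" "\<lambda>t. g (x + t *\<^sub>R e)", OF _ d c]
      by (simp add: F_def mult.commute)
  qed
  have "AE x in lborel. (LINT t|lborel. F t x) = G (x + e) - G x"
    using line by eventually_elim (rule increment)
  then have "(LINT x|lborel. LINT t|lborel. F t x) = (LINT x|lborel. G (x + e) - G x)"
    by (intro integral_cong_AE) (simp_all add: F_def)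
  also have "\<dots> = 0"
    using shift[OF G, of e] G by simp
  finally have "(LINT t|lborel. LINT x|lborel. F t x) = 0"
    using lborel_pair.Fubini_integral[OF int] by simp
  moreover have "(LINT x|lborel. F t x) = indicator {0..1} t * (LINT x|lborel. g x)" for t
    using shift(2)[OF g] by (simp add: F_def)
  ultimately show ?thesis by simp
qed

section \<open>Test functions and integration by parts\<close>

lemma smooth_continuous: "smooth \<phi> \<Longrightarrow> continuous_on UNIV \<phi>"
  unfolding smooth_def by (metis Ck.simps(1))

lemma smooth_has_derivative: "smooth \<phi> \<Longrightarrow> (\<phi> has_derivative frechet_derivative \<phi> (at x)) (at x)"
  unfolding smooth_def by (metis Ck.simps(2) frechet_derivative_works)

lemma smooth_continuous_frechet_derivative:
  "smooth \<phi> \<Longrightarrow> b \<in> Basis \<Longrightarrow> continuous_on UNIV (\<lambda>x. frechet_derivative \<phi> (at x) b)"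
  unfolding smooth_def by (metis Ck.simps)

lemma frechet_derivative_eq_0_off_support:
  fixes \<phi> :: "'a::euclidean_space \<Rightarrow> real"
  assumes "x \<notin> closure {x. \<phi> x \<noteq> 0}"
  shows "frechet_derivative \<phi> (at x) v = 0"
proof -
  have "(\<phi> has_derivative (\<lambda>_. 0)) (at x)"
    by (rule has_derivative_transform_within_open[of "\<lambda>_. 0" _ _ _ "- closure {x. \<phi> x \<noteq> 0}"])
      (use assms closure_subset[of "{x. \<phi> x \<noteq> 0}"] in auto)
  then show ?thesis by (simp add: frechet_derivative_at[symmetric])
qed

text \<open>A continuous function is bounded on the compact set \<open>C\<close>, so the product is
  dominated by a multiple of \<open>F\<close> restricted to \<open>C\<close>.\<close>

lemma integrable_mult_compact_support:
  fixes F \<psi> :: "'a::euclidean_space \<Rightarrow> real"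
  assumes F: "F \<in> borel_measurable borel" "set_integrable lebesgue C F"
    and C: "compact C" and \<psi>: "continuous_on UNIV \<psi>" and supp: "\<And>x. x \<notin> C \<Longrightarrow> \<psi> x = 0"
  shows "integrable lborel (\<lambda>x. F x * \<psi> x)"
proof -
  have [measurable]: "F \<in> borel_measurable borel" "C \<in> sets borel" "\<psi> \<in> borel_measurable borel"
    using F C \<psi> by (auto simp: borel_compact borel_measurable_continuous_onI)
  have "bounded (\<psi> ` C)"
    using C \<psi> by (intro compact_imp_bounded compact_continuous_image)
      (auto intro: continuous_on_subset)
  then obtain B where B: "\<And>x. x \<in> C \<Longrightarrow> \<bar>\<psi> x\<bar> \<le> B" unfolding bounded_iff by auto
  have "integrable lborel (\<lambda>x. indicator C x *\<^sub>R F x)"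
    using F(2) unfolding set_integrable_def by (subst (asm) integrable_completion) auto
  then have "integrable lborel (\<lambda>x. B * (indicator C x *\<^sub>R F x))" by simp
  then show ?thesis
  proof (rule Bochner_Integration.integrable_bound)
    have "\<bar>F x * \<psi> x\<bar> \<le> \<bar>B * (indicator C x *\<^sub>R F x)\<bar>" for x
    proof (cases "x \<in> C")
      case True
      then have "\<bar>\<psi> x\<bar> \<le> \<bar>B\<bar>" using B[of x] by linarith
      then have "\<bar>\<psi> x\<bar> * \<bar>F x\<bar> \<le> \<bar>B\<bar> * \<bar>F x\<bar>" by (rule mult_right_mono) simp
      then show ?thesis using True by (simp add: abs_mult mult.commute)
    qed (simp add: supp)
    then show "AE x in lborel. norm (F x * \<psi> x) \<le> norm (B * (indicator C x *\<^sub>R F x))" by simp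
  qed measurable
qed

text \<open>Apply \<open>integral_directional_derivative_eq_0\<close> to the product of
  \<open>F\<close> and \<open>\<phi>\<close>, whose derivative along \<open>e\<close> is given by
  the product rule. The singular point contributes no boundary term.\<close>

lemma integration_by_parts_punctured:
  fixes F F' :: "'a::euclidean_space \<Rightarrow> real"
  assumes dim: "2 \<le> DIM('a)" and e: "e \<in> Basis" and \<phi>: "test_function UNIV \<phi>"
    and meas: "F \<in> borel_measurable borel" "F' \<in> borel_measurable borel"
    and int: "\<And>C. compact C \<Longrightarrow> set_integrable lebesgue C F"
      "\<And>C. compact C \<Longrightarrow> set_integrable lebesgue C F'"
    and cont: "continuous_on (- {0}) F" "continuous_on (- {0}) F'"
    and deriv: "\<And>x. x \<noteq> 0 \<Longrightarrow> ((\<lambda>t. F (x + t *\<^sub>R e)) has_real_derivative F' x) (at 0)"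
  shows "(LINT x:UNIV|lebesgue. F x * frechet_derivative \<phi> (at x) e) =
    - (LINT x:UNIV|lebesgue. F' x * \<phi> x)"
proof -
  define C where "C = closure {x. \<phi> x \<noteq> 0}"
  define \<phi>' where "\<phi>' x = frechet_derivative \<phi> (at x) e" for x
  have sm: "smooth \<phi>" and C: "compact C" using \<phi> by (auto simp: test_function_def C_def)
  note c = smooth_continuous[OF sm] smooth_continuous_frechet_derivative[OF sm e, folded \<phi>'_def]
  note [measurable] = meas c[THEN borel_measurable_continuous_onI]
  have supp: "x \<notin> C \<Longrightarrow> \<phi> x = 0" "x \<notin> C \<Longrightarrow> \<phi>' x = 0" for x
    using closure_subset[of "{x. \<phi> x \<noteq> 0}"] frechet_derivative_eq_0_off_support[of x \<phi> e]
    by (auto simp: C_def \<phi>'_def)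
  have i: "integrable lborel (\<lambda>x. F x * \<phi> x)" "integrable lborel (\<lambda>x. F x * \<phi>' x)"
    "integrable lborel (\<lambda>x. F' x * \<phi> x)"
    by (intro integrable_mult_compact_support[of _ C] meas int C c supp; assumption)+
  have "(LINT x|lborel. F x * \<phi>' x + F' x * \<phi> x) = 0"
  proof (rule integral_directional_derivative_eq_0[OF dim i(1), where e = e])
    show "integrable lborel (\<lambda>x. F x * \<phi>' x + F' x * \<phi> x)" using i by simp
    show "continuous_on (- {0}) (\<lambda>x. F x * \<phi>' x + F' x * \<phi> x)"
      using cont c by (intro continuous_intros) (auto intro: continuous_on_subset)
    fix x :: 'a assume "x \<noteq> 0"
    have "(\<phi> has_derivative frechet_derivative \<phi> (at x)) (at (x + 0 *\<^sub>R e))"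
      using smooth_has_derivative[OF sm] by simp
    moreover have "((\<lambda>t. x + t *\<^sub>R e) has_derivative (\<lambda>t. t *\<^sub>R e)) (at 0)"
      by (auto intro!: derivative_eq_intros)
    ultimately have "((\<lambda>t. \<phi> (x + t *\<^sub>R e)) has_derivative (\<lambda>t. frechet_derivative \<phi> (at x) (t *\<^sub>R e))) (at 0)"
      by (rule has_derivative_compose[rotated])
    moreover have "frechet_derivative \<phi> (at x) (t *\<^sub>R e) = \<phi>' x * t" for t
      unfolding \<phi>'_def using linear_frechet_derivative[of \<phi> "at x"] smooth_has_derivative[OF sm, of x]
      by (simp add: linear_scale differentiableI)
    ultimately have "((\<lambda>t. \<phi> (x + t *\<^sub>R e)) has_real_derivative \<phi>' x) (at 0)"
      by (simp add: has_field_derivative_def)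
    from DERIV_mult[OF deriv[OF \<open>x \<noteq> 0\<close>] this]
    show "((\<lambda>t. F (x + t *\<^sub>R e) * \<phi> (x + t *\<^sub>R e)) has_real_derivative
        F x * \<phi>' x + F' x * \<phi> x) (at 0)" by (simp add: algebra_simps)
  qed
  then show ?thesis
    using i unfolding \<phi>'_def[symmetric] by (simp add: set_lebesgue_integral_def integral_completion)
qed

section \<open>Differentials of rotationally symmetric maps\<close>

text \<open>The upper block is \<open>a\<close> times the identity plus \<open>p\<close> times the
  outer product of \<open>x\<close> with itself. This is the shape of the Jacobian of a map with
  horizontal part u(r) x and height h(r), where \<open>a\<close> = u(r), \<open>p\<close> = u'(r)/r
  and \<open>q\<close> = h'(r)/r.\<close>

definition radial_matrix :: "real \<Rightarrow> real \<Rightarrow> real \<Rightarrow> real^2 \<Rightarrow> real^2^3" where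
  "radial_matrix a p q x = vector
     [vector [a + p * x$1 * x$1, p * x$1 * x$2],
      vector [p * x$2 * x$1, a + p * x$2 * x$2],
      vector [q * x$1, q * x$2]]"

lemma norm_square_2: "(norm (x :: real^2))\<^sup>2 = (x$1)\<^sup>2 + (x$2)\<^sup>2"
  unfolding power2_norm_eq_inner by (simp add: inner_vec_def sum_2 power2_eq_square)

lemma norm_square_3: "(norm (x :: real^3))\<^sup>2 = (x$1)\<^sup>2 + (x$2)\<^sup>2 + (x$3)\<^sup>2"
  unfolding power2_norm_eq_inner by (simp add: inner_vec_def sum_3 power2_eq_square)

text \<open>In the frame of \<open>x\<close> and its orthogonal complement the columns of the matrix are orthogonal,
  with lengths whose squares are the two quantities bounded by \<open>M\<close>.\<close>

lemma norm_radial_matrix_mult_le: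
  assumes "x \<noteq> 0" "a\<^sup>2 \<le> M" "(a + p * (norm x)\<^sup>2)\<^sup>2 + (q * norm x)\<^sup>2 \<le> M"
  shows "(norm (radial_matrix a p q x *v v))\<^sup>2 \<le> M * (norm v)\<^sup>2"
proof -
  define r2 where "r2 = (norm x)\<^sup>2"
  have r2: "0 < r2" "r2 = (x$1)\<^sup>2 + (x$2)\<^sup>2"
    unfolding r2_def using assms(1) by simp (rule norm_square_2)
  \<comment> \<open>\<open>s\<close> and \<open>t\<close> are the squared lengths of the components
    of \<open>v\<close> along \<open>x\<close> and orthogonal to \<open>x\<close>; Lagrange's
    identity makes their sum the squared length of \<open>v\<close>.\<close>
  define s where "s = (x$1 * v$1 + x$2 * v$2)\<^sup>2 / r2"
  define t where "t = (x$1 * v$2 - x$2 * v$1)\<^sup>2 / r2"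
  have st: "0 \<le> s" "0 \<le> t" using r2 by (auto simp: s_def t_def)
  have sum: "s + t = (norm v)\<^sup>2"
  proof -
    have "(x$1 * v$1 + x$2 * v$2)\<^sup>2 + (x$1 * v$2 - x$2 * v$1)\<^sup>2 = (norm v)\<^sup>2 * r2"
      unfolding r2(2) norm_square_2 by algebra
    then show ?thesis
      using r2(1) unfolding s_def t_def by (simp add: add_divide_distrib[symmetric])
  qed
  have s: "s * r2 = (x$1 * v$1 + x$2 * v$2)\<^sup>2" using r2(1) by (simp add: s_def)
  have "(norm (radial_matrix a p q x *v v))\<^sup>2 =
      a\<^sup>2 * (norm v)\<^sup>2 + (2 * a * p + p\<^sup>2 * r2 + q\<^sup>2) * (s * r2)"
    unfolding s unfolding norm_square_3 norm_square_2 r2(2)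
    by (simp add: radial_matrix_def matrix_vector_mult_def sum_2) algebra
  also have "\<dots> = a\<^sup>2 * t + ((a + p * r2)\<^sup>2 + q\<^sup>2 * r2) * s"
    unfolding sum[symmetric] by algebra
  also have "\<dots> \<le> M * t + M * s"
    using assms(2,3) st by (intro add_mono mult_right_mono) (auto simp: r2_def power_mult_distrib)
  finally show ?thesis by (simp add: sum[symmetric] algebra_simps)
qed

lemma onorm_square_le:
  fixes A :: "real^'n^'m"
  assumes "\<And>v. (norm (A *v v))\<^sup>2 \<le> M * (norm v)\<^sup>2"
  shows "(onorm ((*v) A))\<^sup>2 \<le> M"
proof -
  have "0 \<le> M" using order_trans[OF zero_le_power2 assms[of "axis undefined 1"]] by simp
  have "norm (A *v v) \<le> sqrt M * norm v" for v
    using real_sqrt_le_mono[OF assms[of v]] by (simp add: real_sqrt_mult)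
  then have "onorm ((*v) A) \<le> sqrt M" by (rule onorm_le)
  then have "(onorm ((*v) A))\<^sup>2 \<le> (sqrt M)\<^sup>2"
    by (intro power_mono) (auto intro: onorm_pos_le matrix_vector_mul_bounded_linear)
  then show ?thesis using \<open>0 \<le> M\<close> by simp
qed

text \<open>The norm of the matrix type is the Frobenius norm, so its square is the sum of the
  squared lengths of the two columns.\<close>

lemma norm_square_le_2_3:
  fixes A :: "real^2^3"
  assumes "\<And>v. (norm (A *v v))\<^sup>2 \<le> M * (norm v)\<^sup>2"
  shows "(norm A)\<^sup>2 \<le> 2 * M"
proof -
  have "(norm A)\<^sup>2 = (norm (A *v axis 1 1))\<^sup>2 + (norm (A *v axis 2 1))\<^sup>2"
    by (simp add: power2_norm_eq_inner inner_vec_def sum_2 sum_3 matrix_vector_mult_def axis_def)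
  then show ?thesis using assms[of "axis 1 1"] assms[of "axis 2 1"] by simp
qed

text \<open>The star of an alternating covector is its value on the standard basis, and
  \<open>A\<close> maps that basis to its columns.\<close>

lemma star_pullback_wedge_coord:
  fixes A :: "real^2^'m"
  assumes "i \<noteq> j"
  shows "star (pullback A (wedge (coord_form i) (coord_form j) y)) = A$i$1 * A$j$2 - A$i$2 * A$j$1"
proof -
  have "alternating (wedge (coord_form i) (coord_form j) y)"
    using volume_form_wedge_coord[OF assms] by (simp add: volume_form_def)
  then have "star (pullback A (wedge (coord_form i) (coord_form j) y)) =
      pullback A (wedge (coord_form i) (coord_form j) y) (mat 1)"
    by (intro star_eq alternating_pullback)
  also have "\<dots> = A$i$1 * A$j$2 - A$i$2 * A$j$1"
    by (simp add: pullback_def wedge_def coord_form_def matrix_vector_mult_def sum_2 mat_def)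
  finally show ?thesis .
qed

text \<open>The upper block has eigenvalue \<open>a\<close> orthogonal to \<open>x\<close> and
  \<open>a + p * (norm x)\<^sup>2\<close> along \<open>x\<close>; the minor is their
  product.\<close>

lemma star_pullback_radial_matrix:
  "star (pullback (radial_matrix a p q x) (wedge (coord_form 1) (coord_form 2) y)) =
    a * (a + p * (norm x)\<^sup>2)"
  unfolding norm_square_2
  by (simp add: star_pullback_wedge_coord radial_matrix_def power2_eq_square algebra_simps)

text \<open>Projecting to the coordinates \<open>i\<close> and \<open>j\<close> does not increase
  lengths, and the determinant of two plane vectors is at most the product of their lengths.\<close>

lemma comass_wedge_coord_le: "comass (wedge (coord_form i) (coord_form j)) p \<le> 1" if "i \<noteq> j"
  unfolding comass_def
proof (rule cSUP_least)
  show "{v :: real^'a^2. \<forall>i. norm (v $ i) \<le> 1} \<noteq> {}"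
    by (auto intro!: exI[of _ 0])
  fix v :: "real^'a^2" assume "v \<in> {v. \<forall>i. norm (v $ i) \<le> 1}"
  then have n: "norm (v $ 1) \<le> 1" "norm (v $ 2) \<le> 1" by auto
  have le: "(w $ i)\<^sup>2 + (w $ j)\<^sup>2 \<le> 1" if "norm w \<le> 1" for w :: "real^'a"
  proof -
    have "(w $ i)\<^sup>2 + (w $ j)\<^sup>2 = (\<Sum>k\<in>{i,j}. (w $ k)\<^sup>2)" using \<open>i \<noteq> j\<close> by simp
    also have "\<dots> \<le> (\<Sum>k\<in>UNIV. (w $ k)\<^sup>2)" by (intro sum_mono2) auto
    also have "\<dots> = (norm w)\<^sup>2"
      unfolding power2_norm_eq_inner by (simp add: inner_vec_def power2_eq_square)
    also have "\<dots> \<le> 1" using that by (simp add: power_le_one)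
    finally show ?thesis .
  qed
  let ?a = "v$1$i" and ?b = "v$1$j" and ?c = "v$2$i" and ?d = "v$2$j"
  \<comment> \<open>Lagrange's identity: squared determinant plus squared inner product equals the
    product of the squared lengths.\<close>
  have "(?a * ?d - ?c * ?b)\<^sup>2 + (?a * ?c + ?b * ?d)\<^sup>2 = (?a\<^sup>2 + ?b\<^sup>2) * (?c\<^sup>2 + ?d\<^sup>2)"
    by algebra
  also have "\<dots> \<le> 1 * 1" using n by (intro mult_mono le) auto
  finally have "(?a * ?d - ?c * ?b)\<^sup>2 \<le> 1" using zero_le_power2[of "?a * ?c + ?b * ?d"] by linarith
  then show "\<bar>wedge (coord_form i) (coord_form j) p v\<bar> \<le> 1"
    by (simp add: wedge_def coord_form_def abs_square_le_1)
qed

section \<open>The curve\<close>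

text \<open>The added constants keep the value at least 1 for all radii, so \<open>1 / l\<close> is
  bounded and \<open>ln l\<close> is nonnegative. Since \<open>1 / 0 = 0\<close>, the value at
  radius 0 is 1.\<close>

definition log_scale :: "real \<Rightarrow> real" where
  "log_scale r = 1 + ln (1 + 1 / r)"

definition spike :: "real^2 \<Rightarrow> real^3" where
  "spike x = (let r = norm x; l = log_scale r in
     vector [1 / (r * l) * x$1, 1 / (r * l) * x$2, ln l])"

text \<open>The parameters come from the profile u = 1/(r l) and the height h = ln l, with l' =
  -1/(r (1 + r)): the second is u'/r and the third is h'/r.\<close>

definition spike_differential :: "real^2 \<Rightarrow> real^2^3" where
  "spike_differential x = (let r = norm x; l = log_scale r in
     radial_matrix (1 / (r * l)) (- (l - 1 / (1 + r)) / (r ^ 3 * l\<^sup>2)) (- 1 / (r\<^sup>2 * (1 + r) * l)) x)"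

section \<open>Logarithmic profile and classical derivatives\<close>

lemma log_scale_ge_1: "0 \<le> r \<Longrightarrow> 1 \<le> log_scale r"
  by (simp add: log_scale_def)

lemma log_scale_le: "0 < r \<Longrightarrow> log_scale r \<le> 1 + 1 / r"
  using ln_add_one_self_le_self[of "1 / r"] by (simp add: log_scale_def)

lemma log_scale_has_derivative:
  assumes "0 < r"
  shows "(log_scale has_real_derivative - 1 / (r * (1 + r))) (at r)"
proof -
  have "((\<lambda>r. 1 + 1 / r) has_real_derivative - 1 / r\<^sup>2) (at r)"
    using assms by (auto intro!: derivative_eq_intros simp: power2_eq_square)
  from DERIV_chain2[OF DERIV_ln_divide this] assms
  have "((\<lambda>r. 1 + ln (1 + 1 / r)) has_real_derivative 0 + 1 / (1 + 1 / r) * (- 1 / r\<^sup>2)) (at r)"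
    by (intro DERIV_add DERIV_const) (auto simp: add_pos_pos)
  moreover have "0 + 1 / (1 + 1 / r) * (- 1 / r\<^sup>2) = - 1 / (r * (1 + r))"
    using assms by (simp add: field_simps power2_eq_square)
  ultimately show ?thesis by (simp add: log_scale_def[abs_def])
qed

lemma continuous_on_log_scale_norm [continuous_intros]:
  "continuous_on (- {0}) (\<lambda>x::'a::real_normed_vector. log_scale (norm x))"
  unfolding log_scale_def
  by (intro continuous_intros) (auto simp: add_pos_pos less_imp_neq[symmetric])

lemma log_scale_measurable [measurable]: "log_scale \<in> borel_measurable borel"
  unfolding log_scale_def[abs_def] by measurable

lemma norm_has_directional_derivative:
  fixes x e :: "'a::real_inner"
  assumes "x \<noteq> 0"
  shows "((\<lambda>t. norm (x + t *\<^sub>R e)) has_real_derivative (x \<bullet> e) / norm x) (at 0)"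
proof -
  have "((\<lambda>t. x + t *\<^sub>R e) has_derivative (\<lambda>t. t *\<^sub>R e)) (at 0)"
    by (auto intro!: derivative_eq_intros)
  from has_derivative_compose[OF this, of norm "\<lambda>h. h \<bullet> sgn x"] has_derivative_norm[OF assms]
  have "((\<lambda>t. norm (x + t *\<^sub>R e)) has_derivative (\<lambda>t. (t *\<^sub>R e) \<bullet> sgn x)) (at 0)"
    by simp
  moreover have "(\<lambda>t. (t *\<^sub>R e) \<bullet> sgn x) = (*) ((x \<bullet> e) / norm x)"
    using assms by (auto simp: sgn_div_norm inner_commute field_simps)
  ultimately show ?thesis by (simp add: has_field_derivative_def)
qed

lemma spike_has_directional_derivative:
  assumes "x \<noteq> 0"
  shows "((\<lambda>t. spike (x + t *\<^sub>R axis i 1) $ k) has_real_derivative spike_differential x $ k $ i) (at 0)"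
proof -
  define r l where "r = norm x" and "l = log_scale r"
  have r: "0 < r" and l: "1 \<le> l" using assms by (auto simp: r_def l_def log_scale_ge_1)
  let ?e = "axis i 1 :: real^2"
  let ?r = "\<lambda>t. norm (x + t *\<^sub>R ?e)"
  have dr: "(?r has_real_derivative x$i / r) (at 0)"
    using norm_has_directional_derivative[OF assms, of ?e] by (simp add: r_def inner_axis)
  have "((\<lambda>t. log_scale (?r t)) has_real_derivative - 1 / (r * (1 + r)) * (x$i / r)) (at 0)"
    by (rule DERIV_chain2[OF _ dr]) (use log_scale_has_derivative[OF r] in \<open>simp add: r_def\<close>)
  then have dl: "((\<lambda>t. log_scale (?r t)) has_real_derivative - x$i / (r\<^sup>2 * (1 + r))) (at 0)"
    by (simp add: power2_eq_square mult_ac)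
  have dx: "((\<lambda>t. (x + t *\<^sub>R ?e) $ j) has_real_derivative (if i = j then 1 else 0)) (at 0)" for j
    by (auto intro!: derivative_eq_intros simp: axis_def)
  have at0: "?r 0 = r" "log_scale (?r 0) = l" by (simp_all add: r_def l_def)
  have "((\<lambda>t. ln (log_scale (?r t))) has_real_derivative 1 / l * (- x$i / (r\<^sup>2 * (1 + r)))) (at 0)"
    by (rule DERIV_chain2[OF _ dl]) (use l DERIV_ln_divide[of l] in \<open>simp add: l_def r_def\<close>)
  then have height: "((\<lambda>t. ln (log_scale (?r t))) has_real_derivative - 1 / (r\<^sup>2 * (1 + r) * l) * x$i) (at 0)"
    by (simp add: mult_ac)
  have "((\<lambda>t. ?r t * log_scale (?r t)) has_real_derivative
      x$i / r * l + - x$i / (r\<^sup>2 * (1 + r)) * r) (at 0)"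
    using DERIV_mult[OF dr dl] unfolding at0 l_def[symmetric] .
  also have "x$i / r * l + - x$i / (r\<^sup>2 * (1 + r)) * r = x$i / r * (l - 1 / (1 + r))"
    using r by (simp add: power2_eq_square right_diff_distrib)
  finally have "((\<lambda>t. ?r t * log_scale (?r t)) has_real_derivative x$i / r * (l - 1 / (1 + r))) (at 0)" .
  from DERIV_inverse_fun[OF this]
  have "((\<lambda>t. 1 / (?r t * log_scale (?r t))) has_real_derivative
      - (x$i / r * (l - 1 / (1 + r))) / (r * l)\<^sup>2) (at 0)"
    unfolding at0 l_def[symmetric] using r l by (simp add: inverse_eq_divide power2_eq_square mult_ac)
  \<comment> \<open>Used with \<open>y = x$i\<close> and \<open>c = l - 1 / (1 + r)\<close>.\<close>
  also have "- (y / r * c) / (r * l)\<^sup>2 = - c / (r ^ 3 * l\<^sup>2) * y" for y c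
    by (simp add: power2_eq_square power3_eq_cube mult_ac)
  finally have du: "((\<lambda>t. 1 / (?r t * log_scale (?r t))) has_real_derivative
      - (l - 1 / (1 + r)) / (r ^ 3 * l\<^sup>2) * x$i) (at 0)" .
  have horizontal: "((\<lambda>t. 1 / (?r t * log_scale (?r t)) * (x + t *\<^sub>R ?e) $ j) has_real_derivative
      (if i = j then 1 / (r * l) else 0) + - (l - 1 / (1 + r)) / (r ^ 3 * l\<^sup>2) * x$j * x$i) (at 0)" for j
    using DERIV_mult[OF du dx[of j]] unfolding at0 l_def[symmetric]
    by (auto simp: r_def l_def mult_ac add.commute cong: if_cong)
  note [simp] = spike_def spike_differential_def radial_matrix_def Let_def
  consider "k = 1" | "k = 2" | "k = 3" using exhaust_3[of k] by blast
  then show ?thesis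
    using horizontal[of 1] horizontal[of 2] height exhaust_2[of i]
    by cases (auto simp flip: r_def l_def)
qed

section \<open>Measurability, and continuity off the origin\<close>

lemma borel_measurable_matrixI:
  fixes A :: "'a \<Rightarrow> real^'n^'m"
  assumes "\<And>k i. (\<lambda>x. A x $ k $ i) \<in> borel_measurable M"
  shows "A \<in> borel_measurable M"
  using assms by (subst borel_measurable_euclidean_space) (auto simp: Basis_vec_def inner_axis)

lemma spike_measurable [measurable]: "spike \<in> borel_measurable borel"
proof (subst borel_measurable_euclidean_space, safe)
  fix b :: "real^3" assume "b \<in> Basis"
  then obtain k where "b = axis k 1" by (auto simp: Basis_vec_def)
  then show "(\<lambda>x. spike x \<bullet> b) \<in> borel_measurable borel"
    using exhaust_3[of k] by (auto simp: inner_axis spike_def Let_def)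
qed

lemma spike_differential_measurable [measurable]: "spike_differential \<in> borel_measurable borel"
proof (rule borel_measurable_matrixI)
  fix k :: 3 and i :: 2
  show "(\<lambda>x. spike_differential x $ k $ i) \<in> borel_measurable borel"
    using exhaust_3[of k] exhaust_2[of i] by (auto simp: spike_differential_def radial_matrix_def Let_def)
qed

lemma continuous_on_spike: "continuous_on (- {0}) (\<lambda>x. spike x $ k)"
proof -
  have "log_scale (norm x) \<noteq> 0" "0 < log_scale (norm x)" for x :: "real^2"
    using log_scale_ge_1[of "norm x"] by auto
  then show ?thesis
    using exhaust_3[of k]
    by (elim disjE; simp add: spike_def Let_def; intro continuous_intros; simp)
qed

lemma continuous_on_spike_differential: "continuous_on (- {0}) (\<lambda>x. spike_differential x $ k $ i)"
proof -
  have "log_scale (norm x) \<noteq> 0" "1 + norm x \<noteq> 0" for x :: "real^2"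
    using log_scale_ge_1[of "norm x"] norm_ge_zero[of x] by (auto simp del: norm_ge_zero)
  then show ?thesis
    using exhaust_3[of k] exhaust_2[of i]
    by (elim disjE; simp add: spike_differential_def radial_matrix_def Let_def;
        intro continuous_intros; simp)
qed

text \<open>Tangentially the map stretches by 1/(r l). In the radial direction the horizontal part
  stretches by (1/l)' = 1/(r (1 + r) l^2), and the height has slope -1/(r (1 + r) l). The Jacobian
  is the product of the first two numbers.\<close>

lemma
  assumes "x \<noteq> 0"
  defines "r \<equiv> norm x" and "l \<equiv> log_scale (norm x)"
  shows norm_spike_differential_mult_le:
      "(norm (spike_differential x *v v))\<^sup>2 \<le> (1 + 1 / l\<^sup>2) / (r * l)\<^sup>2 * (norm v)\<^sup>2"
    and star_pullback_spike:
      "star (pullback (spike_differential x) (wedge (coord_form 1) (coord_form 2) y)) =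
        1 / (r\<^sup>2 * (1 + r) * l ^ 3)"
proof -
  have r: "0 < r" and l: "1 \<le> l" using assms by (auto simp: log_scale_ge_1)
  let ?a = "1 / (r * l)" and ?p = "- (l - 1 / (1 + r)) / (r ^ 3 * l\<^sup>2)" and ?q = "- 1 / (r\<^sup>2 * (1 + r) * l)"
  have D: "spike_differential x = radial_matrix ?a ?p ?q x"
    by (simp add: spike_differential_def Let_def r_def l_def)
  \<comment> \<open>With \<open>c = l - 1 / (1 + r)\<close> the terms \<open>l\<close> cancel, which
    makes the horizontal radial stretch smaller than the tangential one by the factor
    \<open>l * (1 + r)\<close>.\<close>
  have "1 / (r * l) + - c / (r ^ 3 * l\<^sup>2) * r\<^sup>2 = (l - c) / (r * l\<^sup>2)" for c
    using r l by (simp add: field_simps power2_eq_square power3_eq_cube)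
  then have "?a + ?p * r\<^sup>2 = (l - (l - 1 / (1 + r))) / (r * l\<^sup>2)" .
  also have "\<dots> = 1 / (r * l\<^sup>2 * (1 + r))" by simp
  finally have radial: "?a + ?p * r\<^sup>2 = 1 / (r * l\<^sup>2 * (1 + r))" .
  show "(norm (spike_differential x *v v))\<^sup>2 \<le> (1 + 1 / l\<^sup>2) / (r * l)\<^sup>2 * (norm v)\<^sup>2"
    unfolding D
  proof (rule norm_radial_matrix_mult_le[OF assms(1)])
    show "?a\<^sup>2 \<le> (1 + 1 / l\<^sup>2) / (r * l)\<^sup>2"
      by (simp add: power_divide divide_right_mono)
    have "?q * r = - (1 / (r * l) / (1 + r))" using r by (simp add: power2_eq_square mult_ac)
    then have "(?q * r)\<^sup>2 = 1 / (r * l)\<^sup>2 / (1 + r)\<^sup>2" by (simp add: power_divide power_mult_distrib)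
    moreover have "(1 / (r * l\<^sup>2 * (1 + r)))\<^sup>2 = 1 / l\<^sup>2 / (r * l)\<^sup>2 / (1 + r)\<^sup>2"
      by (simp add: power_divide power2_eq_square mult_ac)
    ultimately have "(?a + ?p * r\<^sup>2)\<^sup>2 + (?q * r)\<^sup>2 = (1 + 1 / l\<^sup>2) / (r * l)\<^sup>2 / (1 + r)\<^sup>2"
      unfolding radial by (simp add: add_divide_distrib)
    also have "\<dots> \<le> (1 + 1 / l\<^sup>2) / (r * l)\<^sup>2 / 1"
      using r l by (intro divide_left_mono) (auto simp: one_le_power)
    finally show "(?a + ?p * (norm x)\<^sup>2)\<^sup>2 + (?q * norm x)\<^sup>2 \<le> (1 + 1 / l\<^sup>2) / (r * l)\<^sup>2"
      by (simp add: r_def)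
  qed
  show "star (pullback (spike_differential x) (wedge (coord_form 1) (coord_form 2) y)) =
      1 / (r\<^sup>2 * (1 + r) * l ^ 3)"
    unfolding D star_pullback_radial_matrix r_def[symmetric] radial
    by (simp add: power2_eq_square power3_eq_cube)
qed

text \<open>An upper bound for the quotient of the bound on the squared operator norm by the
  Jacobian. The coefficient of \<open>log_scale\<close> is 1, so the exponential blows up at the
  origin with exponent exactly \<open>lam\<close>.\<close>

definition distortion :: "real^2 \<Rightarrow> real" where
  "distortion x = log_scale (norm x) + 2 * norm x + 2"

lemma norm_spike_differential_square_le:
  assumes "x \<noteq> 0"
  shows "(norm (spike_differential x))\<^sup>2 \<le> 4 / (norm x * log_scale (norm x))\<^sup>2"
proof -
  let ?l = "log_scale (norm x)"
  have "1 / ?l\<^sup>2 \<le> 1" using log_scale_ge_1[of "norm x"] by (simp add: one_le_power)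
  then have "2 * ((1 + 1 / ?l\<^sup>2) / (norm x * ?l)\<^sup>2) \<le> 4 / (norm x * ?l)\<^sup>2"
    by (simp add: divide_right_mono)
  then show ?thesis
    using norm_square_le_2_3[OF norm_spike_differential_mult_le[OF assms]] by (rule order_trans[rotated])
qed

lemma distortion_inequality:
  assumes "x \<noteq> 0"
  shows "comass (wedge (coord_form 1) (coord_form 2)) (spike x) * (onorm ((*v) (spike_differential x)))\<^sup>2
    \<le> distortion x * star (pullback (spike_differential x) (wedge (coord_form 1) (coord_form 2) (spike x)))"
proof -
  define r l where "r = norm x" and "l = log_scale r"
  have r: "0 < r" and l: "1 \<le> l" using assms by (auto simp: r_def l_def log_scale_ge_1)
  \<comment> \<open>The cross term \<open>r * l\<close> stays bounded near the origin, so it does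
    not add to the leading coefficient of \<open>l\<close>.\<close>
  have "r * l \<le> r * (1 + 1 / r)" using r log_scale_le[of r] by (simp add: l_def)
  then have rl: "r * l \<le> r + 1" using r by (simp add: algebra_simps)
  have "(1 + r) * (l + 1 / l) = l + r * l + (1 + r) / l" by (simp add: algebra_simps)
  also have "(1 + r) / l \<le> (1 + r) / 1" using r l by (intro divide_left_mono) auto
  finally have K: "(1 + r) * (l + 1 / l) \<le> distortion x"
    using rl by (simp add: distortion_def r_def l_def)
  have "comass (wedge (coord_form 1) (coord_form 2)) (spike x) * (onorm ((*v) (spike_differential x)))\<^sup>2
      \<le> 1 * (onorm ((*v) (spike_differential x)))\<^sup>2"
    by (intro mult_right_mono comass_wedge_coord_le) auto
  also have "\<dots> \<le> (1 + 1 / l\<^sup>2) / (r * l)\<^sup>2"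
    using onorm_square_le[OF norm_spike_differential_mult_le[OF assms]] by (simp add: r_def l_def)
  also have "\<dots> = (1 + r) * (l + 1 / l) * (1 / (r\<^sup>2 * (1 + r) * l ^ 3))"
    using r l by (simp add: divide_simps power2_eq_square power3_eq_cube)
  also have "\<dots> \<le> distortion x * (1 / (r\<^sup>2 * (1 + r) * l ^ 3))"
    using r l by (intro mult_right_mono K) auto
  finally show ?thesis
    by (simp add: star_pullback_spike[OF assms] r_def l_def)
qed

section \<open>Integrability by dyadic annuli\<close>

lemma log_scale_dyadic_ge:
  assumes "0 < r" "r \<le> 1 / 2 ^ k"
  shows "(real k + 1) / 2 \<le> log_scale r"
proof -
  have "real k / 2 \<le> real k * ln 2"
    using ln2_ge_two_thirds by (intro order_trans[OF _ mult_left_mono[of "1/2" "ln 2"]]) auto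
  also have "\<dots> = ln (2 ^ k)" by (simp add: ln_realpow)
  also have "\<dots> \<le> ln (1 + 1 / r)" using assms by (intro ln_mono) (auto simp: field_simps add_pos_pos)
  finally show ?thesis by (simp add: log_scale_def)
qed

text \<open>The slope \<open>ln 2\<close> in \<open>k\<close> is the sharp one: it turns the
  exponential of \<open>lam\<close> times the profile into a constant times the \<open>k\<close>-th
  power of 2^lam, which leads to the threshold 2.\<close>

lemma log_scale_dyadic_le:
  assumes "1 / 2 ^ Suc k < r"
  shows "log_scale r \<le> 1 + (real k + 2) * ln 2"
proof -
  have r: "0 < r" using assms by (rule le_less_trans[rotated]) simp
  then have "1 / r \<le> 2 ^ Suc k" using assms by (simp add: field_simps)
  also have "1 + \<dots> \<le> 2 ^ (k + 2)" by simp (use one_le_power[of "2::real" k] in linarith)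
  finally have "1 + 1 / r \<le> 2 ^ (k + 2)" by simp
  then have "ln (1 + 1 / r) \<le> ln (2 ^ (k + 2))" using r by (intro ln_mono) (auto simp: add_pos_pos)
  also have "\<dots> = (real k + 2) * ln 2" by (subst ln_realpow) auto
  finally show ?thesis by (simp add: log_scale_def)
qed

text \<open>On the annulus of index \<open>k\<close> the squared norm is at most a constant times
  4^k / (k + 1)^2. The area factor 4^(-k) leaves the convergent series of 1/(k + 1)^2; the logarithm
  supplies this decay.\<close>

lemma set_integrable_spike_differential:
  assumes "compact C"
  shows "set_integrable lebesgue C (\<lambda>x. (norm (spike_differential x))\<^sup>2)"
proof (rule set_integrable_dyadic[where c = "\<lambda>k. 16 * 2 ^ (2 * Suc k) / (real k + 1)\<^sup>2" and B = 4])
  have le: "(norm (spike_differential x))\<^sup>2 \<le> 4 * (s\<^sup>2 / m\<^sup>2)"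
    if "0 < s" "1 / s \<le> norm x" "0 < m" "m \<le> log_scale (norm x)" for x s m
  proof -
    have "0 < norm x" using that by (intro less_le_trans[OF _ that(2)]) simp
    then have "(norm (spike_differential x))\<^sup>2 \<le> 4 / (norm x * log_scale (norm x))\<^sup>2"
      by (intro norm_spike_differential_square_le) simp
    also have "\<dots> \<le> 4 / (1 / s * m)\<^sup>2"
      using that \<open>0 < norm x\<close> by (intro divide_left_mono power_mono mult_mono mult_pos_pos zero_less_power) auto
    finally show ?thesis using that by (simp add: power_divide power_mult_distrib)
  qed
  show "\<bar>(norm (spike_differential x))\<^sup>2\<bar> \<le> 4" if "1 < norm x" for x
    using le[of 1 x 1] that log_scale_ge_1[of "norm x"] by simp
  show "\<bar>(norm (spike_differential x))\<^sup>2\<bar> \<le> 16 * 2 ^ (2 * Suc k) / (real k + 1)\<^sup>2"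
    if "1 / 2 ^ Suc k < norm x" "norm x \<le> 1 / 2 ^ k" for x k
  proof -
    have "0 < norm x" using that(1) by (rule le_less_trans[rotated]) simp
    then have "(norm (spike_differential x))\<^sup>2 \<le> 4 * ((2 ^ Suc k)\<^sup>2 / ((real k + 1) / 2)\<^sup>2)"
      using that log_scale_dyadic_ge[OF _ that(2)] by (intro le) auto
    also have "\<dots> = 16 * 2 ^ (2 * Suc k) / (real k + 1)\<^sup>2"
      unfolding power_mult[of 2 2] power_mult[symmetric] mult.commute[of 2 "Suc k"]
      by (simp add: power_divide)
    finally show ?thesis by simp
  qed
  \<comment> \<open>The constant 64 is 16 times the factor 4 by which \<open>2 ^ (2 * Suc k)\<close>
    exceeds 4^k.\<close>
  have "(\<lambda>k. 16 * 2 ^ (2 * Suc k) / (real k + 1)\<^sup>2 * (1 / 2 ^ k) ^ DIM(real^2)) =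
      (\<lambda>k. 64 * inverse (real (Suc k) ^ 2))"
    by (simp add: fun_eq_iff power_divide field_simps power_mult[symmetric] power_mult_distrib)
      (simp add: mult_2_right power_add)
  moreover have "summable (\<lambda>k. inverse (real (Suc k) ^ 2))"
    using inverse_power_summable[of 2, where 'a = real] by (subst summable_Suc_iff) simp
  ultimately show "summable (\<lambda>k. 16 * 2 ^ (2 * Suc k) / (real k + 1)\<^sup>2 * (1 / 2 ^ k) ^ DIM(real^2))"
    using summable_mult[of "\<lambda>k. inverse (real (Suc k) ^ 2)" 64] by (simp only:)
qed (use assms in auto)

text \<open>The horizontal part has length \<open>1 / l \<le> 1\<close>, and the squared height is
  at most \<open>4 * l\<close>, hence at most \<open>4 * (1 + 1 / r)\<close>. A singularity of order
  1/r is integrable in the plane.\<close>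

lemma set_integrable_spike:
  assumes "compact C"
  shows "set_integrable lebesgue C (\<lambda>x. (norm (spike x))\<^sup>2)"
proof (rule set_integrable_dyadic[where c = "\<lambda>k. 9 * 2 ^ Suc k" and B = 9])
  have le: "(norm (spike x))\<^sup>2 \<le> 5 + 4 / norm x" if "x \<noteq> 0" for x
  proof -
    define r l where "r = norm x" and "l = log_scale r"
    have r: "0 < r" and l: "1 \<le> l" using that by (auto simp: r_def l_def log_scale_ge_1)
    have "(norm (spike x))\<^sup>2 = ((x$1)\<^sup>2 + (x$2)\<^sup>2) / (r * l)\<^sup>2 + (ln l)\<^sup>2"
      by (simp add: norm_square_3 spike_def Let_def r_def l_def power_divide power_mult_distrib add_divide_distrib)
    also have "\<dots> = 1 / l\<^sup>2 + (ln l)\<^sup>2"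
      using r unfolding norm_square_2[symmetric] r_def[symmetric] by (simp add: power_mult_distrib)
    also have "1 / l\<^sup>2 \<le> 1" using l by (simp add: one_le_power)
    \<comment> \<open>Passing to the square root makes the squared logarithm at most linear in
      \<open>l\<close>.\<close>
    also have "ln l = 2 * ln (sqrt l)" using l by (simp add: ln_sqrt)
    also have "(2 * ln (sqrt l))\<^sup>2 \<le> (2 * sqrt l)\<^sup>2"
      using l ln_le_minus_one[of "sqrt l"] by (intro power_mono mult_left_mono) auto
    also have "\<dots> \<le> 4 * (1 + 1 / r)"
      using l log_scale_le[OF r] by (simp add: power_mult_distrib l_def)
    finally show ?thesis by (simp add: r_def)
  qed
  show "\<bar>(norm (spike x))\<^sup>2\<bar> \<le> 9" if "1 < norm x" for x
  proof -
    have "4 / norm x \<le> 4" using that by (simp add: divide_le_eq)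
    moreover have "x \<noteq> 0" using that by auto
    ultimately show ?thesis using le[of x] by simp
  qed
  show "\<bar>(norm (spike x))\<^sup>2\<bar> \<le> 9 * 2 ^ Suc k" if "1 / 2 ^ Suc k < norm x" for x k
  proof -
    have "0 < norm x" using that(1) by (rule le_less_trans[rotated]) simp
    then have "1 / norm x \<le> 2 ^ Suc k" "x \<noteq> 0" using that by (auto simp: field_simps)
    moreover have "1 \<le> (2::real) ^ Suc k" by (rule one_le_power) simp
    ultimately show ?thesis using le[of x] by simp
  qed
  have "(\<lambda>k. 9 * 2 ^ Suc k * (1 / 2 ^ k) ^ DIM(real^2)) = (\<lambda>k. 18 * (1 / 2 :: real) ^ k)"
    by (simp add: fun_eq_iff power_divide power2_eq_square)
  then show "summable (\<lambda>k. 9 * 2 ^ Suc k * (1 / 2 ^ k :: real) ^ DIM(real^2))" by simp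
qed (use assms in auto)

lemma distortion_measurable [measurable]: "distortion \<in> borel_measurable borel"
  unfolding distortion_def[abs_def] by measurable

lemma distortion_ge_3: "3 \<le> distortion x"
  using log_scale_ge_1[of "norm x"] norm_ge_zero[of x] unfolding distortion_def by linarith

text \<open>For nonnegative \<open>lam\<close>, the bounds on the annuli times the areas of the
  balls form a geometric series of ratio 2^lam / 4, which is below 1 precisely when
  \<open>lam < 2\<close>.\<close>

lemma set_integrable_exp_distortion:
  assumes "compact C" "lam < 2"
  shows "set_integrable lebesgue C (\<lambda>x. exp (lam * distortion x))"
proof -
  \<comment> \<open>For negative \<open>lam\<close> an upper bound on the distortion would not bound
    the exponential from above, so the exponent is raised to 0.\<close>
  define m where "m = max lam 0"
  have m: "0 \<le> m" "lam \<le> m" "m < 2" using assms(2) by (auto simp: m_def)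
  obtain R where R: "\<And>x. x \<in> C \<Longrightarrow> norm x \<le> R"
    using compact_imp_bounded[OF assms(1)] unfolding bounded_iff by auto
  have le: "\<bar>exp (lam * distortion x)\<bar> \<le> exp (m * y)" if "distortion x \<le> y" for x y
    using that m distortion_ge_3[of x] by (auto intro: mult_mono)
  \<comment> \<open>The 5 collects the 1 in \<open>log_scale_dyadic_le\<close>, the bound 2 on
    \<open>2 * norm x\<close> in the unit ball, and the constant 2 of
    \<open>distortion\<close>.\<close>
  let ?c = "\<lambda>k. exp (m * (5 + (real k + 2) * ln 2))"
  show ?thesis
  proof (rule set_integrable_dyadic[where c = ?c and B = "exp (m * (4 + 2 * R))"])
    show "\<bar>exp (lam * distortion x)\<bar> \<le> exp (m * (4 + 2 * R))" if "x \<in> C" "1 < norm x" for x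
    proof (rule le)
      have "1 / norm x \<le> 1" using that by (simp add: divide_le_eq)
      then have "log_scale (norm x) \<le> 2" using log_scale_le[of "norm x"] that by linarith
      then show "distortion x \<le> 4 + 2 * R" using R[OF that(1)] by (simp add: distortion_def)
    qed
    show "\<bar>exp (lam * distortion x)\<bar> \<le> ?c k"
      if "1 / 2 ^ Suc k < norm x" "norm x \<le> 1 / 2 ^ k" for x k
    proof (rule le)
      have "norm x \<le> 1" using that(2) by (rule order_trans) (simp add: one_le_power)
      then show "distortion x \<le> 5 + (real k + 2) * ln 2"
        using log_scale_dyadic_le[OF that(1)] by (simp add: distortion_def)
    qed
    have "exp (m * ln 2) < exp (2 * ln 2)" using m by simp
    also have "exp (2 * ln 2) = (4::real)" using exp_add[of "ln 2" "ln (2::real)"] by simp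
    finally have "summable (\<lambda>k. exp (m * (5 + 2 * ln 2)) * (exp (m * ln 2) / 4) ^ k)"
      by (intro summable_mult summable_geometric) simp
    moreover have "?c k * (1 / 2 ^ k) ^ DIM(real^2) = exp (m * (5 + 2 * ln 2)) * (exp (m * ln 2) / 4) ^ k" for k
    proof -
      have "?c k = exp (m * (5 + 2 * ln 2)) * exp (m * ln 2) ^ k"
        unfolding exp_of_nat_mult[symmetric] exp_add[symmetric] by (simp add: algebra_simps)
      moreover have "(1 / 2 ^ k) ^ 2 = (1 / 4 :: real) ^ k"
        unfolding power_divide power_mult[symmetric] by (simp add: power_mult mult.commute[of k])
      ultimately show ?thesis by (simp add: power_divide)
    qed
    ultimately show "summable (\<lambda>k. ?c k * (1 / 2 ^ k) ^ DIM(real^2))" by simp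
  qed (use assms in auto)
qed

section \<open>Local Lebesgue spaces and the weak differential\<close>

lemma borel_imp_lebesgue_on_UNIV_measurable:
  "f \<in> borel_measurable borel \<Longrightarrow> f \<in> borel_measurable (lebesgue_on UNIV)"
  by (simp add: lebesgue_on_UNIV_eq measurable_completion)

lemma borel_measurable_matrix_entry: "(\<lambda>A::real^'n^'m. A $ i $ j) \<in> borel_measurable borel"
  by (intro borel_measurable_continuous_onI continuous_intros)

lemma set_integrable_dominated:
  fixes g h :: "'a::euclidean_space \<Rightarrow> real"
  assumes "set_integrable lebesgue C h" "compact C" "g \<in> borel_measurable borel"
    and "\<And>x. \<bar>g x\<bar> \<le> h x"
  shows "set_integrable lebesgue C g"
proof (rule set_integrable_bound[OF assms(1)])
  have "C \<in> sets lebesgue" using assms(2) by (intro fmeasurableD lmeasurable_compact)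
  moreover have "g \<in> borel_measurable lebesgue"
    using assms(3) by (intro measurable_completion) simp
  ultimately show "set_borel_measurable lebesgue C g"
    unfolding set_borel_measurable_def by (intro borel_measurable_scaleR borel_measurable_indicator)
  show "AE x in lebesgue. x \<in> C \<longrightarrow> norm (g x) \<le> norm (h x)"
    using order_trans[OF assms(4) abs_ge_self] by simp
qed

text \<open>Compact sets have finite measure and t is at most 1 + t^2 for nonnegative t, so local
  square integrability gives both exponents.\<close>

lemma Lp_loc_1_2I:
  fixes f :: "'a::euclidean_space \<Rightarrow> 'b::euclidean_space"
  assumes f: "f \<in> borel_measurable borel"
    and int: "\<And>C. compact C \<Longrightarrow> set_integrable lebesgue C (\<lambda>x. (norm (f x))\<^sup>2)"
  shows "Lp_loc UNIV 1 f" "Lp_loc UNIV 2 f"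
proof -
  have "set_integrable lebesgue C (\<lambda>x. norm (f x))" if "compact C" for C
  proof (rule set_integrable_dominated[OF _ that])
    have "C \<in> lmeasurable" using that by (rule lmeasurable_compact)
    then have "set_integrable lebesgue C (\<lambda>_. 1 :: real)"
      by (auto simp: set_integrable_def fmeasurable_def intro: integrable_real_indicator)
    then show "set_integrable lebesgue C (\<lambda>x. 1 + (norm (f x))\<^sup>2)"
      by (rule set_integral_add) (rule int[OF that])
    show "(\<lambda>x. norm (f x)) \<in> borel_measurable borel" using f by measurable
    have "norm (f x) \<le> 1 + (norm (f x))\<^sup>2" for x
      using zero_le_power2[of "norm (f x) - 1"] norm_ge_zero[of "f x"] unfolding power2_diff one_power2 by linarith
    then show "\<bar>norm (f x)\<bar> \<le> 1 + (norm (f x))\<^sup>2" for x by simp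
  qed
  then show "Lp_loc UNIV 1 f" "Lp_loc UNIV 2 f"
    using f int by (auto simp: Lp_loc_def borel_imp_lebesgue_on_UNIV_measurable)
qed

lemma Lp_loc_1_set_integrable:
  assumes "Lp_loc UNIV 1 f" "compact C" "g \<in> borel_measurable borel" "\<And>x. \<bar>g x\<bar> \<le> norm (f x)"
  shows "set_integrable lebesgue C g"
proof (rule set_integrable_dominated[OF _ assms(2-4)])
  show "set_integrable lebesgue C (\<lambda>x. norm (f x))"
    using assms(1,2) by (simp add: Lp_loc_def)
qed

lemma Lp_loc_spike: "Lp_loc UNIV 1 spike" "Lp_loc UNIV 2 spike"
  by (intro Lp_loc_1_2I spike_measurable set_integrable_spike; assumption)+

lemma Lp_loc_spike_differential: "Lp_loc UNIV 1 spike_differential" "Lp_loc UNIV 2 spike_differential"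
  by (intro Lp_loc_1_2I spike_differential_measurable set_integrable_spike_differential; assumption)+

text \<open>The classical partial derivatives off the origin are the weak ones: each entry is
  locally integrable because the full norm is, so integration by parts applies entrywise.\<close>

lemma weak_differential_spike: "weak_differential UNIV spike spike_differential"
  unfolding weak_differential_def
proof (intro conjI allI impI)
  fix \<phi> :: "real^2 \<Rightarrow> real" and i :: 2 and k :: 3
  assume "test_function UNIV \<phi>"
  moreover have "(\<lambda>x. spike x $ k) \<in> borel_measurable borel"
    "(\<lambda>x. spike_differential x $ k $ i) \<in> borel_measurable borel"
    by (rule measurable_compose[OF spike_measurable borel_measurable_nth],
        rule measurable_compose[OF spike_differential_measurable borel_measurable_matrix_entry])
  moreover have "\<bar>spike_differential x $ k $ i\<bar> \<le> norm (spike_differential x)" for x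
    by (meson component_le_norm_cart Finite_Cartesian_Product.norm_nth_le order_trans)
  ultimately show "(LINT x:UNIV|lebesgue. spike x $ k * frechet_derivative \<phi> (at x) (axis i 1)) =
      - (LINT x:UNIV|lebesgue. spike_differential x $ k $ i * \<phi> x)"
    by (intro integration_by_parts_punctured continuous_on_spike continuous_on_spike_differential
        spike_has_directional_derivative Lp_loc_1_set_integrable[OF Lp_loc_spike(1)]
        Lp_loc_1_set_integrable[OF Lp_loc_spike_differential(1)])
      (auto simp: axis_in_Basis_iff component_le_norm_cart)
qed (rule Lp_loc_spike Lp_loc_spike_differential)+

text \<open>A two-by-two minor is at most half the sum of the squares of its entries, hence is
  dominated by the squared Frobenius norm.\<close>

lemma Lp_loc_star_pullback:
  fixes D :: "'a::euclidean_space \<Rightarrow> real^2^'m"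
  assumes "i \<noteq> j" and D: "D \<in> borel_measurable borel" "Lp_loc UNIV 2 D"
  shows "Lp_loc UNIV 1 (\<lambda>x. star (pullback (D x) (wedge (coord_form i) (coord_form j) (f x))))"
  unfolding star_pullback_wedge_coord[OF assms(1)] Lp_loc_def
proof (intro conjI allI impI)
  note [measurable] = measurable_compose[OF D(1) borel_measurable_matrix_entry]
  have [measurable]: "(\<lambda>x. D x$i$1 * D x$j$2 - D x$i$2 * D x$j$1) \<in> borel_measurable borel" by measurable
  then show "(\<lambda>x. D x$i$1 * D x$j$2 - D x$i$2 * D x$j$1) \<in> borel_measurable (lebesgue_on UNIV)"
    by (rule borel_imp_lebesgue_on_UNIV_measurable)
  fix C :: "'a set" assume C: "compact C \<and> C \<subseteq> UNIV"
  have bound: "\<bar>A$i$1 * A$j$2 - A$i$2 * A$j$1\<bar> \<le> (norm A)\<^sup>2" for A :: "real^2^'m"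
  proof -
    have sq: "(norm v)\<^sup>2 = (v$1)\<^sup>2 + (v$2)\<^sup>2" for v :: "real^2" by (rule norm_square_2)
    have "(norm (A$i))\<^sup>2 + (norm (A$j))\<^sup>2 = (\<Sum>k\<in>{i,j}. (norm (A$k))\<^sup>2)" using assms(1) by simp
    also have "\<dots> \<le> (\<Sum>k\<in>UNIV. (norm (A$k))\<^sup>2)" by (intro sum_mono2) auto
    also have "\<dots> = (norm A)\<^sup>2" by (simp add: power2_norm_eq_inner inner_vec_def[of A])
    finally show ?thesis
      using zero_le_power2[of "A$i$1 - A$j$2"] zero_le_power2[of "A$i$1 + A$j$2"]
        zero_le_power2[of "A$i$2 - A$j$1"] zero_le_power2[of "A$i$2 + A$j$1"]
      unfolding sq abs_le_iff power2_sum power2_diff by linarith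
  qed
  show "set_integrable lebesgue C (\<lambda>x. norm (D x$i$1 * D x$j$2 - D x$i$2 * D x$j$1) powr 1)"
  proof (rule set_integrable_dominated)
    show "set_integrable lebesgue C (\<lambda>x. norm (D x) powr 2)"
      using C D(2) unfolding Lp_loc_def by blast
    show "(\<lambda>x. norm (D x$i$1 * D x$j$2 - D x$i$2 * D x$j$1) powr 1) \<in> borel_measurable borel"
      by measurable
    show "\<bar>norm (D x$i$1 * D x$j$2 - D x$i$2 * D x$j$1) powr 1\<bar> \<le> norm (D x) powr 2" for x
      using bound[of "D x"] by simp
  qed (use C in simp)
qed

text \<open>The height \<open>ln l\<close> tends to infinity at the origin, whereas a continuous
  representative is bounded near it. The two could agree almost everywhere only if a small ball were
  a null set.\<close>

lemma not_has_continuous_representative_spike: "\<not> has_continuous_representative UNIV spike"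
proof
  assume "has_continuous_representative UNIV spike"
  then obtain g where g: "continuous_on UNIV g" "AE x in lebesgue. g x = spike x"
    unfolding has_continuous_representative_def lebesgue_on_UNIV_eq by blast
  have "isCont (\<lambda>x. g x $ 3) 0"
    using g(1) by (auto simp: continuous_on_eq_continuous_at intro!: continuous_intros)
  from this[unfolded continuous_at_eps_delta, rule_format, of 1]
  obtain d where d: "0 < d" "\<And>x. norm x < d \<Longrightarrow> \<bar>g x $ 3 - g 0 $ 3\<bar> < 1"
    by (auto simp: dist_norm)
  define M where "M = g 0 $ 3 + 1"
  \<comment> \<open>Below radius \<open>d\<close> the third component of \<open>g\<close> is less
    than \<open>M\<close>. Below \<open>exp (- exp M)\<close> the number \<open>- ln r\<close>
    exceeds \<open>exp M\<close>, so \<open>l\<close> does too and the height exceeds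
    \<open>M\<close>.\<close>
  define s where "s = min d (exp (- exp M))"
  have s: "0 < s" using d by (simp add: s_def)
  have blowup: "x \<notin> ball 0 s" if "x \<noteq> 0" "g x = spike x" for x
  proof
    assume "x \<in> ball 0 s"
    then have x: "norm x < d" "norm x < exp (- exp M)" by (auto simp: s_def)
    have "exp M = - ln (exp (- exp M))" by simp
    also have "\<dots> < - ln (norm x)" using x that(1) by (subst neg_less_iff_less, subst ln_less_cancel_iff) auto
    also have "\<dots> = ln (1 / norm x)" using that(1) by (simp add: ln_div)
    also have "\<dots> \<le> ln (1 + 1 / norm x)" using that(1) by (intro ln_mono) (auto simp: add_pos_pos)
    also have "\<dots> < log_scale (norm x)" by (simp add: log_scale_def)
    finally have "ln (exp M) < ln (log_scale (norm x))"
      using log_scale_ge_1[of "norm x"] by (subst ln_less_cancel_iff) auto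
    then have "M < g x $ 3" unfolding that(2) by (simp add: spike_def Let_def)
    then show False using d(2)[OF x(1)] by (auto simp: M_def)
  qed
  have "AE x in lebesgue. x \<notin> ball (0 :: real^2) s"
    using g(2) AE_completion[OF AE_lborel_singleton[of "0 :: real^2"]]
    by eventually_elim (rule blowup)
  then have "AE x in lborel. x \<notin> ball (0 :: real^2) s" by (simp only: AE_completion_iff)
  then have "emeasure lborel (ball (0 :: real^2) s) = 0"
    by (subst (asm) AE_iff_measurable[of "ball 0 s"]) auto
  then show False using s unit_ball_vol_pos[of 2] by (simp add: emeasure_ball)
qed

theorem theorem1p1:
  fixes lam :: real
  assumes "lam < 2"
  shows "\<exists>(f :: real^2 \<Rightarrow> real^3) (K :: real^2 \<Rightarrow> ereal).
           finite_distortion_curve UNIV (wedge (coord_form 1) (coord_form 2)) f K \<and>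
           W1p_loc UNIV 2 f \<and>
           Lp_loc UNIV 1 (\<lambda>x. exp (lam * real_of_ereal (K x))) \<and>
           \<not> has_continuous_representative UNIV f"
proof (intro exI conjI)
  let ?K = "\<lambda>x. ereal (distortion x)"
  show "finite_distortion_curve UNIV (wedge (coord_form 1) (coord_form 2)) spike ?K"
    unfolding finite_distortion_curve_def
  proof (intro conjI exI[of _ spike_differential])
    show "volume_form (wedge (coord_form (1::3)) (coord_form 2))"
      by (rule volume_form_wedge_coord) simp
    show "W1p_loc UNIV 1 spike"
      unfolding W1p_loc_def using Lp_loc_spike Lp_loc_spike_differential weak_differential_spike by blast
    show "?K \<in> borel_measurable (lebesgue_on UNIV)"
      by (intro borel_imp_lebesgue_on_UNIV_measurable) measurable
    show "\<forall>x\<in>UNIV. 1 \<le> ?K x"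
      using distortion_ge_3 by (auto intro: order_trans[of _ 3])
    show "Lp_loc UNIV 1 (\<lambda>x. star (pullback (spike_differential x)
        (wedge (coord_form 1) (coord_form 2) (spike x))))"
      by (intro Lp_loc_star_pullback spike_differential_measurable Lp_loc_spike_differential) simp
    \<comment> \<open>The pointwise inequality was established off the origin, which is a null
      set.\<close>
    have "AE x in lebesgue. x \<noteq> (0 :: real^2)"
      by (intro AE_completion AE_lborel_singleton)
    then show "AE x in lebesgue_on UNIV. ereal (comass (wedge (coord_form 1) (coord_form 2)) (spike x) *
        onorm ((*v) (spike_differential x)) ^ CARD(2)) \<le>
        ?K x * ereal (star (pullback (spike_differential x) (wedge (coord_form 1) (coord_form 2) (spike x))))"
      unfolding lebesgue_on_UNIV_eq by eventually_elim (simp add: distortion_inequality)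
  qed (auto simp: weak_differential_spike)
  show "W1p_loc UNIV 2 spike"
    unfolding W1p_loc_def using Lp_loc_spike Lp_loc_spike_differential weak_differential_spike by blast
  show "Lp_loc UNIV 1 (\<lambda>x. exp (lam * real_of_ereal (?K x)))"
    unfolding Lp_loc_def using assms
    by (auto intro!: set_integrable_exp_distortion borel_imp_lebesgue_on_UNIV_measurable)
qed (rule not_has_continuous_representative_spike)

end
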